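(* Let $n\ge 2$ be an integer, let $a:\{1,\ldots,n\}\to\mathbb{R}$ satisfy $a_i<a_{i+1}$ for all $1\le i<n$, and let $E\in\mathbb{R}$ with $a_1<E<a_n$. Define $f,I_f:\mathbb{R}\to\mathbb{R}$ by \[f(x)=\frac{\sum_{i=1}^n a_i e^{x a_i}}{\sum_{i=1}^n e^{x a_i}}-E,\qquad I_f(x)=x-\frac{f(x)}{(a_n-a_1)^2}.\] Then: (i) For all $x\in\mathbb{R}$, $0<I_f'(x)<1$. (ii) The map $I_f$ has a unique fixed point $\lambda\in\mathbb{R}$, and for each $x\in\mathbb{R}$ the iterates satisfy $I_f^k(x)\to\lambda$ as $k\to\infty$.
   Context: $I_f^k$ denotes the $k$-fold composition of $I_f$ with itself, and $I_f'$ the derivative of $I_f$. *)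

theory Defs
  imports "HOL-Analysis.Analysis"
begin

text \<open>Only the values of \<open>a\<close> on \<open>{1..n}\<close> are used.\<close>

definition f :: "nat \<Rightarrow> (nat \<Rightarrow> real) \<Rightarrow> real \<Rightarrow> real \<Rightarrow> real" where
  "f n a E x = (\<Sum>i=1..n. a i * exp (x * a i)) / (\<Sum>i=1..n. exp (x * a i)) - E"

definition I_f :: "nat \<Rightarrow> (nat \<Rightarrow> real) \<Rightarrow> real \<Rightarrow> real \<Rightarrow> real" where
  "I_f n a E x = x - f n a E x / (a n - a 1)\<^sup>2"

end

theory Submission
  imports Defs
begin

text \<open>
  The quotient in \<open>f\<close> is the mean of the numbers \<open>a\<^sub>i\<close> under the Gibbs weights proportional to
  \<open>exp (x * a\<^sub>i)\<close>, and its derivative in \<open>x\<close> is the variance under the same weights. Let \<open>D\<close>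
  be the range \<open>a\<^sub>n - a\<^sub>1\<close>. The variance is positive, since the \<open>a\<^sub>i\<close> are not all equal, and it is
  less than \<open>D\<^sup>2\<close>, since it is at most the second moment about \<open>a\<^sub>1\<close>, in which no term exceeds
  \<open>D\<^sup>2\<close> and the first one vanishes. Hence the derivative of \<open>I_f\<close>, which is \<open>1\<close> minus the
  variance divided by \<open>D\<^sup>2\<close>, lies strictly between \<open>0\<close> and \<open>1\<close>.

  A fixed point of \<open>I_f\<close> is a zero of \<open>f\<close>. One exists because the mean exceeds \<open>E\<close> for some
  \<open>x\<close> and falls below \<open>E\<close> for another: large positive \<open>x\<close> favour the largest \<open>a\<^sub>i\<close>, large
  negative \<open>x\<close> the smallest (lemma \<open>exponential_tilt_pos\<close>). The derivative bound is not uniform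
  in \<open>x\<close>, so Banach's theorem does not apply; but \<open>I_f\<close> strictly decreases distances, and on the
  real line this suffices, once a fixed point is known, for every orbit to converge to it
  (lemma \<open>iterates_tendsto_fixed_point\<close>).
\<close>

text \<open>
  The distance of the orbit to the fixed point decreases to some limit. At an accumulation
  point \<open>z\<close> of the orbit, both \<open>z\<close> and \<open>T z\<close> lie at exactly that limiting distance, which strict
  shrinking allows only if \<open>z\<close> is the fixed point; so the limiting distance is \<open>0\<close>.
\<close>
lemma iterates_tendsto_fixed_point:
  fixes T :: "'a::heine_borel \<Rightarrow> 'a"
  assumes shrink: "\<And>x y. x \<noteq> y \<Longrightarrow> dist (T x) (T y) < dist x y" and fixed: "T l = l"
  shows "(\<lambda>k. (T ^^ k) x) \<longlonglongrightarrow> l"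
proof -
  define X where "X k = (T ^^ k) x" for k
  have X_Suc: "X (Suc k) = T (X k)" for k by (simp add: X_def)
  have nonexp: "dist (T u) (T v) \<le> dist u v" for u v
    using shrink[of u v] by (cases "u = v") auto
  have dec: "decseq (\<lambda>k. dist (X k) l)"
    by (rule decseq_SucI) (metis X_Suc nonexp fixed)
  then obtain d where d: "(\<lambda>k. dist (X k) l) \<longlonglongrightarrow> d"
    using decseq_convergent[of "\<lambda>k. dist (X k) l" 0] by auto
  have "X k \<in> cball l (dist (X 0) l)" for k
    using decseqD[OF dec, of 0 k] by (simp add: dist_commute)
  then obtain z r where r: "strict_mono r" and z: "(X \<circ> r) \<longlonglongrightarrow> z"
    using compact_cball[of l "dist (X 0) l"] unfolding compact_def by metis
  have cont: "isCont T z"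
    unfolding continuous_at_eps_delta using nonexp by (meson order_le_less_trans)
  have "(\<lambda>k. dist ((X \<circ> r) k) l) \<longlonglongrightarrow> dist z l"
    using z by (intro tendsto_intros)
  moreover have "(\<lambda>k. dist ((X \<circ> r) k) l) \<longlonglongrightarrow> d"
    using LIMSEQ_subseq_LIMSEQ[OF d r] by (simp add: o_def)
  ultimately have dz: "dist z l = d"
    by (rule LIMSEQ_unique)
  have "(\<lambda>k. dist (T ((X \<circ> r) k)) l) \<longlonglongrightarrow> dist (T z) l"
    using isCont_tendsto_compose[OF cont z] by (intro tendsto_intros)
  moreover have "(\<lambda>k. dist (T ((X \<circ> r) k)) l) \<longlonglongrightarrow> d"
    using LIMSEQ_subseq_LIMSEQ[OF LIMSEQ_Suc[OF d] r] by (simp add: o_def X_Suc)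
  ultimately have "dist (T z) l = d"
    by (rule LIMSEQ_unique)
  with dz fixed shrink[of z l] have "d = 0"
    by (cases "z = l") auto
  with d show ?thesis
    unfolding X_def by (simp add: tendsto_dist_iff[of _ l])
qed

lemma dist_less_if_abs_deriv_less_1:
  fixes T T' :: "real \<Rightarrow> real"
  assumes der: "\<And>x. (T has_real_derivative T' x) (at x)" and bd: "\<And>x. \<bar>T' x\<bar> < 1"
    and "x \<noteq> y"
  shows "dist (T x) (T y) < dist x y"
proof -
  have *: "dist (T u) (T v) < dist u v" if "u < v" for u v
  proof -
    obtain z where "T v - T u = (v - u) * T' z"
      using MVT2[OF \<open>u < v\<close>, of T T'] der by blast
    then have "\<bar>T v - T u\<bar> = (v - u) * \<bar>T' z\<bar>"
      using that by (simp add: abs_mult)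
    also have "\<dots> < (v - u) * 1"
      using that bd[of z] by (intro mult_strict_left_mono) auto
    finally show ?thesis
      using that by (simp add: dist_real_def)
  qed
  show ?thesis
    using *[of x y] *[of y x] \<open>x \<noteq> y\<close> by (cases "x < y") (auto simp: dist_commute)
qed

text \<open>
  The parallel axis identity. The centre \<open>c\<close> is left free because the two bounds on the variance
  come from two different centres: the mean and the smallest value.
\<close>
lemma weighted_variance_shift:
  fixes a w :: "'i \<Rightarrow> real" and A :: "'i set"
  defines "W \<equiv> \<Sum>i\<in>A. w i"
  defines "m \<equiv> (\<Sum>i\<in>A. a i * w i) / W"
  assumes "W \<noteq> 0"
  shows "(\<Sum>i\<in>A. (a i)\<^sup>2 * w i) / W - m\<^sup>2 = (\<Sum>i\<in>A. (a i - c)\<^sup>2 * w i) / W - (m - c)\<^sup>2"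
proof -
  have M: "(\<Sum>i\<in>A. a i * w i) = m * W"
    using \<open>W \<noteq> 0\<close> by (simp add: m_def)
  have "(\<Sum>i\<in>A. (a i - c)\<^sup>2 * w i) = (\<Sum>i\<in>A. (a i)\<^sup>2 * w i - 2 * c * (a i * w i) + c\<^sup>2 * w i)"
    by (intro sum.cong) (auto simp: power2_eq_square algebra_simps)
  also have "\<dots> = (\<Sum>i\<in>A. (a i)\<^sup>2 * w i) - 2 * c * (m * W) + c\<^sup>2 * W"
    by (simp add: sum.distrib sum_subtractf M W_def flip: sum_distrib_left)
  finally show ?thesis
    using \<open>W \<noteq> 0\<close> by (simp add: field_simps power2_eq_square)
qed

lemma weighted_variance_pos:
  fixes a w :: "'i \<Rightarrow> real"
  assumes "finite A" and w: "\<And>i. i \<in> A \<Longrightarrow> 0 < w i"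
    and "i \<in> A" "j \<in> A" "a i \<noteq> a j"
  shows "0 < (\<Sum>i\<in>A. (a i)\<^sup>2 * w i) / (\<Sum>i\<in>A. w i)
           - ((\<Sum>i\<in>A. a i * w i) / (\<Sum>i\<in>A. w i))\<^sup>2"
proof -
  define m where "m = (\<Sum>i\<in>A. a i * w i) / (\<Sum>i\<in>A. w i)"
  have W: "0 < (\<Sum>i\<in>A. w i)"
    using assms by (intro sum_pos) auto
  obtain k where k: "k \<in> A" "a k \<noteq> m"
    using assms by metis
  have "0 < (\<Sum>i\<in>A. (a i - m)\<^sup>2 * w i)"
    using \<open>finite A\<close> k w by (intro sum_pos2[of A k]) (auto simp: less_imp_le)
  then show ?thesis
    using W weighted_variance_shift[of w A a m] by (simp add: m_def)
qed

text \<open>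
  The variance is at most the second moment about \<open>a j\<close>. Strictness comes from the single index
  \<open>j\<close>, whose term in that moment is \<open>0\<close>.
\<close>
lemma weighted_variance_less_square_radius:
  fixes a w :: "'i \<Rightarrow> real"
  assumes "finite A" and w: "\<And>i. i \<in> A \<Longrightarrow> 0 < w i"
    and "j \<in> A" and radius: "\<And>i. i \<in> A \<Longrightarrow> \<bar>a i - a j\<bar> \<le> D" and "0 < D"
  shows "(\<Sum>i\<in>A. (a i)\<^sup>2 * w i) / (\<Sum>i\<in>A. w i)
           - ((\<Sum>i\<in>A. a i * w i) / (\<Sum>i\<in>A. w i))\<^sup>2 < D\<^sup>2"
    (is "?V < _")
proof -
  define W where "W = (\<Sum>i\<in>A. w i)"
  have W: "0 < W"
    unfolding W_def using assms by (intro sum_pos) auto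
  have "(\<Sum>i\<in>A. (a i - a j)\<^sup>2 * w i) < (\<Sum>i\<in>A. D\<^sup>2 * w i)"
  proof (rule sum_strict_mono_ex1)
    show "\<forall>i\<in>A. (a i - a j)\<^sup>2 * w i \<le> D\<^sup>2 * w i"
      using radius w \<open>0 < D\<close>
      by (auto intro!: mult_right_mono simp: less_imp_le abs_le_square_iff[symmetric])
    show "\<exists>i\<in>A. (a i - a j)\<^sup>2 * w i < D\<^sup>2 * w i"
      using \<open>j \<in> A\<close> w \<open>0 < D\<close> by (intro bexI[of _ j]) auto
  qed (fact \<open>finite A\<close>)
  then have "(\<Sum>i\<in>A. (a i - a j)\<^sup>2 * w i) / W < D\<^sup>2"
    using W by (simp add: pos_divide_less_eq W_def sum_distrib_left)
  moreover have "?V \<le> (\<Sum>i\<in>A. (a i - a j)\<^sup>2 * w i) / W"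
    using W weighted_variance_shift[of w A a "a j"] by (simp add: W_def)
  ultimately show ?thesis
    by linarith
qed

lemma gibbs_mean_has_derivative_variance:
  fixes a :: "'i \<Rightarrow> real"
  assumes "finite A" "A \<noteq> {}"
  shows "((\<lambda>x. (\<Sum>i\<in>A. a i * exp (x * a i)) / (\<Sum>i\<in>A. exp (x * a i))) has_real_derivative
      ((\<Sum>i\<in>A. (a i)\<^sup>2 * exp (x * a i)) / (\<Sum>i\<in>A. exp (x * a i))
        - ((\<Sum>i\<in>A. a i * exp (x * a i)) / (\<Sum>i\<in>A. exp (x * a i)))\<^sup>2)) (at x)"
proof -
  have Z: "(\<Sum>i\<in>A. exp (x * a i)) \<noteq> 0"
    using sum_pos[OF assms, of "\<lambda>i. exp (x * a i)"] by simp
  have num: "((\<lambda>x. \<Sum>i\<in>A. a i * exp (x * a i)) has_real_derivative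
      (\<Sum>i\<in>A. (a i)\<^sup>2 * exp (x * a i))) (at x)"
    by (auto intro!: derivative_eq_intros sum.cong simp: power2_eq_square)
  have den: "((\<lambda>x. \<Sum>i\<in>A. exp (x * a i)) has_real_derivative
      (\<Sum>i\<in>A. a i * exp (x * a i))) (at x)"
    by (auto intro!: derivative_eq_intros sum.cong)
  show ?thesis
    by (rule DERIV_cong[OF DERIV_divide[OF num den Z]])
      (use Z in \<open>simp add: field_simps power2_eq_square\<close>)
qed

text \<open>
  For \<open>x \<ge> 0\<close>, \<open>u * exp (x * u) \<ge> u\<close> whatever the sign of \<open>u\<close>, so the terms other than \<open>j\<close> are
  bounded below independently of \<open>x\<close>, while the term \<open>j\<close> grows at least linearly.
\<close>
lemma exponential_tilt_pos:
  fixes u :: "'i \<Rightarrow> real"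
  assumes "finite A" "j \<in> A" "0 < u j"
  shows "\<exists>x. 0 < (\<Sum>i\<in>A. u i * exp (x * u i))"
proof -
  define S where "S = (\<Sum>i\<in>A. u i)"
  define x where "x = (\<bar>S\<bar> + 1) / (u j)\<^sup>2"
  have x: "0 \<le> x" "x * (u j)\<^sup>2 = \<bar>S\<bar> + 1"
    using assms by (auto simp: x_def)
  have term_ge: "u i \<le> u i * exp (x * u i)" for i
  proof (cases "0 \<le> u i")
    case True
    then have "u i * 1 \<le> u i * exp (x * u i)"
      using x by (intro mult_left_mono) auto
    then show ?thesis by simp
  next
    case False
    then have "u i * 1 \<le> u i * exp (x * u i)"
      using x by (intro mult_left_mono_neg) (auto simp: mult_nonneg_nonpos)
    then show ?thesis by simp
  qed
  have "u j * (1 + x * u j) \<le> u j * exp (x * u j)"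
    using assms by (intro mult_left_mono exp_ge_add_one_self) auto
  then have j: "u j + x * (u j)\<^sup>2 \<le> u j * exp (x * u j)"
    by (simp add: power2_eq_square algebra_simps)
  have "S + x * (u j)\<^sup>2 = (u j + x * (u j)\<^sup>2) + (\<Sum>i\<in>A - {j}. u i)"
    using assms by (simp add: S_def sum.remove)
  also have "\<dots> \<le> u j * exp (x * u j) + (\<Sum>i\<in>A - {j}. u i * exp (x * u i))"
    by (intro add_mono j sum_mono term_ge)
  also have "\<dots> = (\<Sum>i\<in>A. u i * exp (x * u i))"
    using assms by (simp add: sum.remove)
  finally show ?thesis
    using x by (intro exI[of _ x]) linarith
qed

text \<open>
  Replacing \<open>a\<^sub>i\<close> by \<open>a\<^sub>i - E\<close> shifts the mean by \<open>E\<close>, since the factor \<open>exp (- x * E)\<close> cancels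
  from the weights. This puts the sign of \<open>f\<close> in the form of lemma \<open>exponential_tilt_pos\<close>.
\<close>
lemma f_centred:
  assumes "0 < n"
  shows "f n a E x = (\<Sum>i=1..n. (a i - E) * exp (x * (a i - E))) / (\<Sum>i=1..n. exp (x * (a i - E)))"
proof -
  have Z: "0 < (\<Sum>i=1..n. exp (x * a i))"
    using assms by (intro sum_pos) auto
  have e: "exp (x * (a i - E)) = exp (x * a i) * exp (- (x * E))" for i
    by (simp add: right_diff_distrib flip: exp_add)
  have "(\<Sum>i=1..n. (a i - E) * exp (x * (a i - E)))
      = ((\<Sum>i=1..n. a i * exp (x * a i)) - E * (\<Sum>i=1..n. exp (x * a i))) * exp (- (x * E))"
    unfolding e
    by (simp add: sum_distrib_left sum_distrib_right algebra_simps flip: sum_subtractf)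
  moreover have "(\<Sum>i=1..n. exp (x * (a i - E))) = (\<Sum>i=1..n. exp (x * a i)) * exp (- (x * E))"
    unfolding e by (simp add: sum_distrib_right)
  ultimately show ?thesis
    using Z by (simp add: f_def diff_divide_distrib)
qed

lemma f_has_zero:
  assumes "0 < n" "a 1 < E" "E < a n" and cont: "\<And>x. isCont (f n a E) x"
  shows "\<exists>l. f n a E l = 0"
proof -
  have Z: "0 < (\<Sum>i=1..n. exp (x * (a i - E)))" for x
    using \<open>0 < n\<close> by (intro sum_pos) auto
  obtain p where "0 < (\<Sum>i=1..n. (a i - E) * exp (p * (a i - E)))"
    using exponential_tilt_pos[of "{1..n}" n "\<lambda>i. a i - E"] assms by auto
  then have p: "0 < f n a E p"
    using Z[of p] \<open>0 < n\<close> by (simp add: f_centred)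
  obtain q where "0 < (\<Sum>i=1..n. (E - a i) * exp (q * (E - a i)))"
    using exponential_tilt_pos[of "{1..n}" 1 "\<lambda>i. E - a i"] assms by auto
  also have "\<dots> = - (\<Sum>i=1..n. (a i - E) * exp (- q * (a i - E)))"
    unfolding sum_negf[symmetric] by (intro sum.cong) (auto simp: algebra_simps)
  finally have "f n a E (- q) < 0"
    using Z[of "- q"] \<open>0 < n\<close> by (simp add: f_centred divide_neg_pos)
  then have "\<exists>l\<in>closed_segment (- q) p. f n a E l = 0"
    using p cont by (intro IVT'_closed_segment_real)
      (auto simp: closed_segment_eq_real_ivl intro: continuous_at_imp_continuous_on)
  then show ?thesis by blast
qed

theorem lemma4p1:
  fixes n :: nat and a :: "nat \<Rightarrow> real" and E :: real
  assumes "n \<ge> 2"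
    and "\<And>i. 1 \<le> i \<Longrightarrow> i < n \<Longrightarrow> a i < a (i + 1)"
    and "a 1 < E" and "E < a n"
  shows "(\<forall>x. I_f n a E field_differentiable (at x)
            \<and> 0 < deriv (I_f n a E) x \<and> deriv (I_f n a E) x < 1)
       \<and> (\<exists>l. I_f n a E l = l \<and> (\<forall>y. I_f n a E y = y \<longrightarrow> y = l)
            \<and> (\<forall>x. (\<lambda>k. (I_f n a E ^^ k) x) \<longlonglongrightarrow> l))"
proof -
  define D where "D = a n - a 1"
  have D: "0 < D"
    using assms by (simp add: D_def)
  have mono: "a i \<le> a j" if "1 \<le> i" "i \<le> j" "j \<le> n" for i j
    using that(2,3,1)
  proof (induction j rule: dec_induct)
    case (step k)
    then show ?case using assms(2)[of k] by auto
  qed simp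
  define V where "V x = (\<Sum>i=1..n. (a i)\<^sup>2 * exp (x * a i)) / (\<Sum>i=1..n. exp (x * a i))
      - ((\<Sum>i=1..n. a i * exp (x * a i)) / (\<Sum>i=1..n. exp (x * a i)))\<^sup>2" for x
  have V_pos: "0 < V x" for x
    unfolding V_def using assms D
    by (intro weighted_variance_pos[of _ _ 1 n]) (auto simp: D_def)
  have V_less: "V x < D\<^sup>2" for x
    unfolding V_def
  proof (rule weighted_variance_less_square_radius[where j = 1])
    show "\<bar>a i - a 1\<bar> \<le> D" if "i \<in> {1..n}" for i
      using mono[of 1 i] mono[of i n] that by (auto simp: D_def)
  qed (use assms D in auto)
  have der_f: "(f n a E has_real_derivative V x) (at x)" for x
    using DERIV_diff[OF gibbs_mean_has_derivative_variance[of "{1..n}" a x] DERIV_const[of E]] assms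
    by (simp add: f_def[abs_def] V_def)
  have der: "(I_f n a E has_real_derivative 1 - V x / D\<^sup>2) (at x)" for x
    unfolding I_f_def[abs_def] D_def[symmetric]
    by (intro DERIV_diff DERIV_ident DERIV_cdivide der_f)
  have bounds: "0 < 1 - V x / D\<^sup>2" "1 - V x / D\<^sup>2 < 1" for x
    using V_pos[of x] V_less[of x] D by auto
  have shrink: "dist (I_f n a E x) (I_f n a E y) < dist x y" if "x \<noteq> y" for x y
  proof (rule dist_less_if_abs_deriv_less_1[OF der _ that])
    show "\<bar>1 - V z / D\<^sup>2\<bar> < 1" for z
      using bounds[of z] by linarith
  qed
  obtain l where "f n a E l = 0"
    using f_has_zero[of n a E] DERIV_isCont[OF der_f] assms by auto
  then have l: "I_f n a E l = l"
    by (simp add: I_f_def)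
  have "y = l" if "I_f n a E y = y" for y
    using shrink[of y l] that l by auto
  moreover have "(\<lambda>k. (I_f n a E ^^ k) x) \<longlonglongrightarrow> l" for x
    by (rule iterates_tendsto_fixed_point[OF shrink l])
  moreover have "I_f n a E field_differentiable (at x)" for x
    using der field_differentiable_def by blast
  moreover have "0 < deriv (I_f n a E) x" "deriv (I_f n a E) x < 1" for x
    using DERIV_imp_deriv[OF der[of x]] bounds[of x] by simp_all
  ultimately show ?thesis
    using l by blast
qed

end
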